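(* Let $\mathbb{X}$ be a finite dimensional smooth and strictly convex real Banach space and let $T \in \mathbb{L}(\mathbb{X})$ satisfy the Daugavet equation $\|I + T\| = 1 + \|T\|$. Then $\mathbb{X}$ has a $T$-invariant subspace of codimension one.
   Context: $\mathbb{L}(\mathbb{X})$ is the space of bounded linear operators on $\mathbb{X}$ with the operator norm, and $I$ is the identity operator on $\mathbb{X}$. A Banach space is smooth if each point $x$ of its unit sphere has a unique norm-one functional $f$ with $f(x) = 1$. *)

theory Defs
  imports "HOL-Analysis.Analysis"
begin

(* The properties below concern a whole space and therefore take its type as argument.
   The classes real_normed_vector and banach are used instead of euclidean_space because the
   latter forces the norm to come from an inner product. *)

definition finite_dimensional_space :: "'a::real_vector itself \<Rightarrow> bool" where
  "finite_dimensional_space _ \<longleftrightarrow> (\<exists>B :: 'a set. finite B \<and> span B = UNIV)"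

definition smooth_space :: "'a::real_normed_vector itself \<Rightarrow> bool" where
  "smooth_space _ \<longleftrightarrow>
     (\<forall>x :: 'a. norm x = 1 \<longrightarrow> (\<exists>!f :: 'a \<Rightarrow>\<^sub>L real. norm f = 1 \<and> blinfun_apply f x = 1))"

definition strictly_convex_space :: "'a::real_normed_vector itself \<Rightarrow> bool" where
  "strictly_convex_space _ \<longleftrightarrow>
     (\<forall>x :: 'a. norm x = 1 \<longrightarrow> x extreme_point_of (cball 0 1))"

definition daugavet_equation :: "('a::real_normed_vector \<Rightarrow>\<^sub>L 'a) \<Rightarrow> bool" where
  "daugavet_equation T \<longleftrightarrow> norm (id_blinfun + T) = 1 + norm T"

definition invariant_subspace :: "('a::real_normed_vector \<Rightarrow>\<^sub>L 'a) \<Rightarrow> 'a set \<Rightarrow> bool" where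
  "invariant_subspace T V \<longleftrightarrow> subspace V \<and> blinfun_apply T ` V \<subseteq> V"

end

theory Submission
  imports Defs
begin

text \<open>
  The subspace is the kernel of an eigenvector \<open>g\<close> of the adjoint of \<open>T\<close>: once
  \<open>g \<circ> T = \<parallel>T\<parallel> \<cdot> g\<close> with \<open>g \<noteq> 0\<close>, the kernel of \<open>g\<close> is \<open>T\<close>-invariant and has codimension one.

  To find \<open>g\<close>, use that in finite dimension the norm of \<open>I + T\<close> is attained at some unit vector
  \<open>x\<close> (the unit sphere is compact, \<open>compact_span_Int_cball\<close>), so that the Daugavet equation reads
  \<open>\<parallel>x + T x\<parallel> = 1 + \<parallel>T\<parallel>\<close>. A norm-one functional \<open>g\<close> that norms \<open>x + T x\<close> satisfies
  \<open>g x + g (T x) = 1 + \<parallel>T\<parallel>\<close>, where the summands are at most \<open>1\<close> and \<open>\<parallel>T\<parallel>\<close>; both bounds are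
  therefore equalities. Hence \<open>g\<close> and, for \<open>T \<noteq> 0\<close>, also \<open>(g \<circ> T) / \<parallel>T\<parallel>\<close> are norm-one
  functionals with value \<open>1\<close> at \<open>x\<close>, and smoothness at \<open>x\<close> makes them equal.
\<close>

text \<open>
  Closedness can be tested inside balls, because every convergent sequence is bounded.
\<close>

lemma closed_if_compact_Int_cball:
  fixes S :: "'a::real_normed_vector set"
  assumes "\<And>r. compact (S \<inter> cball 0 r)"
  shows "closed S"
  unfolding closed_sequential_limits
proof (intro allI impI)
  fix u l assume u: "(\<forall>n. u n \<in> S) \<and> u \<longlonglongrightarrow> l"
  then have "Bseq u"
    by (meson convergentI convergent_imp_Bseq)
  then obtain K where K: "\<And>n. norm (u n) \<le> K"
    by (auto simp: Bseq_def)
  have "l \<in> S \<inter> cball 0 K"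
    by (rule closed_sequentially[OF compact_imp_closed[OF assms]]) (use u K in auto)
  then show "l \<in> S" by simp
qed

text \<open>
  Heine--Borel for finitely generated subspaces of a normed space, by induction on the
  generators: if \<open>b\<close> lies outside the closed subspace \<open>span C\<close>, its distance to that subspace
  bounds the \<open>b\<close>-coordinate of every vector of norm at most \<open>r\<close>, hence also the remaining
  component in \<open>span C\<close>. The truncated span is thus cut out of the image of a compact product.
\<close>

lemma compact_span_Int_cball:
  fixes B :: "'a::real_normed_vector set"
  assumes "finite B"
  shows "compact (span B \<inter> cball 0 r)"
  using assms
proof (induction B arbitrary: r rule: finite_induct)
  case empty
  then show ?case by (auto intro: finite_imp_compact)
next
  case (insert b C)
  show ?case
  proof (cases "b \<in> span C")
    case True
    then show ?thesis using insert.IH by (simp add: span_redundant)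
  next
    case False
    define d where "d = infdist b (span C)"
    have "closed (span C)"
      using insert.IH by (rule closed_if_compact_Int_cball)
    then have d: "d > 0"
      unfolding d_def using False span_zero by (intro infdist_pos_not_in_closed) auto
    have coord: "\<bar>k\<bar> * d \<le> norm (k *\<^sub>R b + v)" if v: "v \<in> span C" for k v
    proof (cases "k = 0")
      case False
      have "- (v /\<^sub>R k) \<in> span C"
        using v by (simp add: span_neg span_mul)
      then have "d \<le> dist b (- (v /\<^sub>R k))"
        unfolding d_def by (rule infdist_le)
      then have "\<bar>k\<bar> * d \<le> \<bar>k\<bar> * norm (b + v /\<^sub>R k)"
        by (simp add: dist_norm mult_left_mono)
      also have "\<dots> = norm (k *\<^sub>R (b + v /\<^sub>R k))"
        by simp
      also have "k *\<^sub>R (b + v /\<^sub>R k) = k *\<^sub>R b + v"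
        using False by (simp add: scaleR_add_right)
      finally show ?thesis .
    qed simp
    define K where "K = r / d"
    define P where "P = {-K..K} \<times> (span C \<inter> cball 0 (r + K * norm b))"
    let ?f = "\<lambda>p. fst p *\<^sub>R b + snd p"
    have "compact P"
      unfolding P_def using insert.IH by (intro compact_Times) auto
    then have "compact (?f ` P)"
      by (intro compact_continuous_image continuous_intros)
    then have "compact (?f ` P \<inter> cball 0 r)"
      by (intro compact_Int_closed) auto
    moreover have "span (insert b C) \<inter> cball 0 r = ?f ` P \<inter> cball 0 r"
    proof (intro equalityI subsetI)
      fix z assume z: "z \<in> span (insert b C) \<inter> cball 0 r"
      then obtain k where k: "z - k *\<^sub>R b \<in> span C"
        by (auto simp: span_breakdown_eq)
      have "\<bar>k\<bar> * d \<le> r"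
        using coord[OF k, of k] z by auto
      then have K: "\<bar>k\<bar> \<le> K"
        using d by (simp add: K_def field_simps)
      have "norm (z - k *\<^sub>R b) \<le> norm z + \<bar>k\<bar> * norm b"
        using norm_triangle_ineq4[of z "k *\<^sub>R b"] by simp
      also have "\<dots> \<le> r + K * norm b"
        using z K by (intro add_mono mult_right_mono) auto
      finally have "(k, z - k *\<^sub>R b) \<in> P"
        using k K by (auto simp: P_def)
      then have "?f (k, z - k *\<^sub>R b) \<in> ?f ` P"
        by (rule imageI)
      then show "z \<in> ?f ` P \<inter> cball 0 r"
        using z by simp
    next
      fix z assume "z \<in> ?f ` P \<inter> cball 0 r"
      then obtain k v where z: "z = k *\<^sub>R b + v" "v \<in> span C" "z \<in> cball 0 r"
        by (auto simp: P_def)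
      then have "z - k *\<^sub>R b \<in> span C"
        by simp
      then have "z \<in> span (insert b C)"
        unfolding span_breakdown_eq by blast
      then show "z \<in> span (insert b C) \<inter> cball 0 r"
        using z(3) by blast
    qed
    ultimately show ?thesis by simp
  qed
qed

lemma norm_blinfun_attained:
  fixes A :: "'a::real_normed_vector \<Rightarrow>\<^sub>L 'b::real_normed_vector"
  assumes fin: "finite_dimensional_space TYPE('a)" and "A \<noteq> 0"
  obtains x where "norm x = 1" "norm (blinfun_apply A x) = norm A"
proof -
  obtain B :: "'a set" where B: "finite B" "span B = UNIV"
    using fin unfolding finite_dimensional_space_def by blast
  have "compact (cball (0::'a) 1)"
    using compact_span_Int_cball[OF B(1), of 1] B(2) by simp
  moreover have "closed (sphere (0::'a) 1)"
    unfolding sphere_def by (intro closed_Collect_eq continuous_intros)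
  ultimately have "compact (cball (0::'a) 1 \<inter> sphere 0 1)"
    by (rule compact_Int_closed)
  moreover have "cball (0::'a) 1 \<inter> sphere 0 1 = sphere 0 1"
    by auto
  ultimately have "compact (sphere (0::'a) 1)"
    by simp
  moreover obtain z where "blinfun_apply A z \<noteq> 0"
    using \<open>A \<noteq> 0\<close> by (metis blinfun_eqI zero_blinfun.rep_eq)
  then have "z \<noteq> 0"
    by (auto simp: blinfun.zero_right)
  then have "z /\<^sub>R norm z \<in> sphere 0 1"
    by simp
  then have "sphere (0::'a) 1 \<noteq> {}"
    by blast
  moreover have "continuous_on (sphere 0 1) (\<lambda>y. norm (blinfun_apply A y))"
    by (intro continuous_intros)
  ultimately have "\<exists>x\<in>sphere 0 1. \<forall>y\<in>sphere 0 1. norm (blinfun_apply A y) \<le> norm (blinfun_apply A x)"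
    by (rule continuous_attains_sup)
  then obtain x where x: "norm x = 1"
    and max: "\<And>y. norm y = 1 \<Longrightarrow> norm (blinfun_apply A y) \<le> norm (blinfun_apply A x)"
    by auto
  have "norm A \<le> norm (blinfun_apply A x)"
  proof (rule norm_blinfun_bound)
    fix y
    show "norm (blinfun_apply A y) \<le> norm (blinfun_apply A x) * norm y"
    proof (cases "y = 0")
      case False
      then have "norm (blinfun_apply A (y /\<^sub>R norm y)) \<le> norm (blinfun_apply A x)"
        by (intro max) simp
      then show ?thesis
        using False by (simp add: blinfun.scaleR_right divide_simps)
    qed (simp add: blinfun.zero_right)
  qed simp
  with norm_blinfun[of A x] x have "norm (blinfun_apply A x) = norm A"
    by simp
  with x show thesis by (rule that)
qed

text \<open>
  A basis of the kernel becomes a basis of the space when \<open>x\<close> is added: subtracting from \<open>y\<close> the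
  multiple \<open>g y / g x\<close> of \<open>x\<close> leaves a vector in the kernel.
\<close>

lemma dim_kernel_functional:
  fixes g :: "'a::real_vector \<Rightarrow> real"
  assumes fin: "finite_dimensional_space TYPE('a)" and g: "linear g" and x: "g x \<noteq> 0"
  shows "dim {y. g y = 0} + 1 = dim (UNIV :: 'a set)"
proof -
  let ?V = "{y. g y = 0}"
  have V: "subspace ?V"
    by (rule linear_subspace_kernel[OF g])
  obtain B where B: "B \<subseteq> ?V" "independent B" "?V \<subseteq> span B" "card B = dim ?V"
    by (rule basis_exists)
  obtain F :: "'a set" where F: "finite F" "span F = UNIV"
    using fin unfolding finite_dimensional_space_def by blast
  have "finite B"
    using independent_span_bound[OF F(1) B(2)] F(2) by simp
  have "span B \<subseteq> ?V"
    using B(1) V by (rule span_minimal)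
  then have xB: "x \<notin> span B"
    using x by auto
  then have "independent (insert x B)"
    using B(2) by (simp add: independent_insertI)
  moreover have "y \<in> span (insert x B)" for y
  proof -
    have "g (y - (g y / g x) *\<^sub>R x) = 0"
      using x by (simp add: linear_diff[OF g] linear_cmul[OF g])
    then show ?thesis
      using B(3) by (auto simp: span_breakdown_eq)
  qed
  then have "span (insert x B) = UNIV"
    by auto
  ultimately have "dim (UNIV :: 'a set) = card (insert x B)"
    using dim_span_eq_card_independent[of "insert x B"] by simp
  also have "\<dots> = card B + 1"
  proof -
    have "x \<notin> B"
      using xB span_base by blast
    then show ?thesis
      using \<open>finite B\<close> by simp
  qed
  finally show ?thesis
    using B(4) by simp
qed

lemma smooth_space_norming_unique:
  fixes x :: "'a::real_normed_vector" and f g :: "'a \<Rightarrow>\<^sub>L real"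
  assumes "smooth_space TYPE('a)" and "norm x = 1"
    and "norm f = 1" "blinfun_apply f x = 1" and "norm g = 1" "blinfun_apply g x = 1"
  shows "f = g"
  using assms unfolding smooth_space_def by blast

lemma smooth_space_norming_exists:
  fixes z :: "'a::real_normed_vector"
  assumes "smooth_space TYPE('a)" and "z \<noteq> 0"
  obtains g :: "'a \<Rightarrow>\<^sub>L real" where "norm g = 1" "blinfun_apply g z = norm z"
proof -
  have "norm (z /\<^sub>R norm z) = 1"
    using \<open>z \<noteq> 0\<close> by simp
  then have "\<exists>!g :: 'a \<Rightarrow>\<^sub>L real. norm g = 1 \<and> blinfun_apply g (z /\<^sub>R norm z) = 1"
    using assms(1) unfolding smooth_space_def by blast
  then obtain g :: "'a \<Rightarrow>\<^sub>L real" where "norm g = 1" "blinfun_apply g (z /\<^sub>R norm z) = 1"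
    by (auto dest: ex1_implies_ex)
  with \<open>z \<noteq> 0\<close> show thesis
    by (intro that[of g]) (simp_all add: blinfun.scaleR_right divide_simps)
qed

text \<open>
  Smoothness turns equality in the norm estimate of \<open>g \<circ> T\<close> into an eigenvalue equation: both
  \<open>g\<close> and the normalized \<open>g \<circ> T\<close> are the norming functional at \<open>x\<close>.
\<close>

lemma smooth_space_adjoint_eigenvector:
  fixes T :: "'a::real_normed_vector \<Rightarrow>\<^sub>L 'a" and g :: "'a \<Rightarrow>\<^sub>L real"
  assumes smooth: "smooth_space TYPE('a)" and x: "norm x = 1"
    and g: "norm g = 1" "blinfun_apply g x = 1"
    and gT: "blinfun_apply g (blinfun_apply T x) = norm T"
  shows "blinfun_apply g (blinfun_apply T y) = norm T * blinfun_apply g y"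
proof (cases "T = 0")
  case True
  then show ?thesis by (simp add: blinfun.zero_right)
next
  case False
  define h where "h = (g o\<^sub>L T) /\<^sub>R norm T"
  have hx: "blinfun_apply h x = 1"
    using False gT by (simp add: h_def blinfun.scaleR_left)
  have "norm (g o\<^sub>L T) \<le> norm T"
    using norm_blinfun_compose[of g T] g by simp
  then have "norm h \<le> 1"
    using False by (simp add: h_def field_simps)
  moreover have "1 \<le> norm h"
    using norm_blinfun[of h x] hx x by simp
  ultimately have "h = g"
    using smooth_space_norming_unique[OF smooth x _ hx g] by simp
  then have "blinfun_apply h y = blinfun_apply g y"
    by simp
  then show ?thesis
    using False by (simp add: h_def blinfun.scaleR_left field_simps)
qed

theorem corollary2p2p2:
  fixes T :: "'a::banach \<Rightarrow>\<^sub>L 'a"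
  assumes "finite_dimensional_space TYPE('a)"
    and "smooth_space TYPE('a)"
    and "strictly_convex_space TYPE('a)"
    and "daugavet_equation T"
  shows "\<exists>V. invariant_subspace T V \<and> dim V + 1 = dim (UNIV :: 'a set)"
proof -
  have dav: "norm (id_blinfun + T) = 1 + norm T"
    using assms(4) by (simp add: daugavet_equation_def)
  then have "norm (id_blinfun + T) \<noteq> 0"
    using norm_ge_zero[of T] by linarith
  then have "id_blinfun + T \<noteq> 0"
    by simp
  then obtain x where x: "norm x = 1"
    and "norm (blinfun_apply (id_blinfun + T) x) = norm (id_blinfun + T)"
    using norm_blinfun_attained[OF assms(1)] by blast
  then have att: "norm (x + blinfun_apply T x) = 1 + norm T"
    using dav by (simp add: blinfun.add_left)
  then have "norm (x + blinfun_apply T x) \<noteq> 0"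
    using norm_ge_zero[of T] by linarith
  then have "x + blinfun_apply T x \<noteq> 0"
    by simp
  then obtain g :: "'a \<Rightarrow>\<^sub>L real" where g: "norm g = 1"
    and "blinfun_apply g (x + blinfun_apply T x) = norm (x + blinfun_apply T x)"
    using smooth_space_norming_exists[OF assms(2)] by blast
  then have sum: "blinfun_apply g x + blinfun_apply g (blinfun_apply T x) = 1 + norm T"
    using att by (simp add: blinfun.add_right)
  have le1: "blinfun_apply g x \<le> 1"
    using norm_blinfun[of g x] g x by simp
  have "blinfun_apply g (blinfun_apply T x) \<le> norm (blinfun_apply T x)"
    using norm_blinfun[of g "blinfun_apply T x"] g by simp
  also have "\<dots> \<le> norm T"
    using norm_blinfun[of T x] x by simp
  finally have leT: "blinfun_apply g (blinfun_apply T x) \<le> norm T" .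
  have gx: "blinfun_apply g x = 1" and gTx: "blinfun_apply g (blinfun_apply T x) = norm T"
    using sum le1 leT by linarith+
  note eig = smooth_space_adjoint_eigenvector[OF assms(2) x g gx gTx]
  have lin: "linear (blinfun_apply g)"
    by (simp add: blinfun.bounded_linear_right bounded_linear.linear)
  let ?V = "{y. blinfun_apply g y = 0}"
  have "invariant_subspace T ?V"
    unfolding invariant_subspace_def
    using linear_subspace_kernel[OF lin] by (auto simp: eig)
  moreover have "dim ?V + 1 = dim (UNIV :: 'a set)"
    using dim_kernel_functional[OF assms(1) lin, of x] gx by simp
  ultimately show ?thesis by blast
qed

end
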